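(* Let $X$ be a metric space whose completion $\tilde X$ is not locally compact. Then $$\mathrm{cof}(\mathrm{PK}(X))=\mathrm{d}(X)\cdot\mathfrak d\cdot\sup_{\tilde x\in\tilde X}\mathrm{cof}\bigl([\mathrm{ld}(\tilde x)]^{\aleph_0}\bigr).$$
   Context: Precompact means totally bounded. $\mathrm{PK}(X)$ is the family of precompact subsets of $X$, partially ordered by inclusion. For a partially ordered set $P$, $\mathrm{cof}(P)$ is the minimal cardinality of a cofinal subset of $P$ (a subset $C$ such that each $p\in P$ satisfies $p\le c$ for some $c\in C$). $\mathrm{d}(X)$ is the minimal cardinality of a dense subset of $X$. For a point $\tilde x\in\tilde X$, the local density $\mathrm{ld}(\tilde x)$ is the minimal density of a neighborhood of $\tilde x$ in $\tilde X$. $\mathfrak d:=\mathrm{cof}(\mathbb N^{\mathbb N},\le)$, where $f\le g$ iff $f(n)\le g(n)$ for all $n$. For a cardinal $\kappa$, $[\kappa]^{\aleph_0}$ is the family of all countably infinite subsets of $\kappa$, partially ordered by inclusion; if $\kappa$ is finite (as happens for $\kappa=\mathrm{ld}(\tilde x)$ when $\tilde x$ is isolated), it is empty and has cofinality $0$, so it does not contribute to the supremum. *)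

theory Defs
  imports "HOL-Analysis.Analysis"
begin

unbundle cardinal_syntax

text \<open>
  Cardinals are represented, as in the library, by cardinal orders \<open>r\<close> (with \<open>Card_order r\<close>) over
  some carrier type. They are compared by \<open>\<le>o\<close> and identified by \<open>=o\<close>, also across carrier types.
  The minimum below is a chosen minimal element, determined up to \<open>=o\<close> for a nonempty family.
\<close>

definition min_cardinal :: "'a rel set \<Rightarrow> 'a rel" where
  "min_cardinal R = (SOME r. r \<in> R \<and> (\<forall>s\<in>R. r \<le>o s))"

lemma min_cardinal:
  assumes "R \<noteq> {}" and "\<And>r. r \<in> R \<Longrightarrow> Card_order r"
  shows "min_cardinal R \<in> R" and "\<And>s. s \<in> R \<Longrightarrow> min_cardinal R \<le>o s"
proof -
  have "\<exists>r. r \<in> R \<and> (\<forall>s\<in>R. r \<le>o s)"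
    using exists_minim_Card_order[of R] assms by auto
  then have "min_cardinal R \<in> R \<and> (\<forall>s\<in>R. min_cardinal R \<le>o s)"
    unfolding min_cardinal_def by (rule someI_ex)
  then show "min_cardinal R \<in> R" and "\<And>s. s \<in> R \<Longrightarrow> min_cardinal R \<le>o s"
    by auto
qed

text \<open>
  The least upper bound is taken among cardinals over the carrier type of the family. If an upper
  bound exists there, this is the supremum among all cardinals, since every cardinal below one over
  this type is again represented over it. An upper bound always exists: the cardinal of the
  whole type.
\<close>

definition sup_cardinal :: "'a rel set \<Rightarrow> 'a rel" where
  "sup_cardinal R = min_cardinal {s. Card_order s \<and> (\<forall>r\<in>R. r \<le>o s)}"

lemma sup_cardinal:
  fixes R :: "'a rel set"
  assumes "\<And>r. r \<in> R \<Longrightarrow> Card_order r"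
  shows "Card_order (sup_cardinal R)"
    and "\<And>r. r \<in> R \<Longrightarrow> r \<le>o sup_cardinal R"
    and "\<And>s :: 'b rel. Card_order s \<Longrightarrow> (\<And>r. r \<in> R \<Longrightarrow> r \<le>o s) \<Longrightarrow> sup_cardinal R \<le>o s"
proof -
  let ?B = "{s :: 'a rel. Card_order s \<and> (\<forall>r\<in>R. r \<le>o s)}"
  have top: "r \<le>o |UNIV :: 'a set|" if "r \<in> R" for r
    by (rule ordIso_ordLeq_trans[OF ordIso_symmetric[OF card_of_Field_ordIso[OF assms[OF that]]]])
      (rule card_of_mono1[OF subset_UNIV])
  then have "|UNIV| \<in> ?B"
    using card_of_Card_order by blast
  then have ne: "?B \<noteq> {}"
    by blast
  have mem: "sup_cardinal R \<in> ?B"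
    unfolding sup_cardinal_def by (rule min_cardinal(1)[OF ne]) auto
  then show co: "Card_order (sup_cardinal R)" and "\<And>r. r \<in> R \<Longrightarrow> r \<le>o sup_cardinal R"
    by auto
  show "sup_cardinal R \<le>o s" if s: "Card_order s" and ub: "\<And>r. r \<in> R \<Longrightarrow> r \<le>o s" for s :: "'b rel"
  proof (rule ccontr)
    assume "\<not> sup_cardinal R \<le>o s"
    then have lt: "s <o sup_cardinal R"
      using not_ordLeq_iff_ordLess card_order_on_well_order_on[OF co] card_order_on_well_order_on[OF s]
      by metis
    then have "s \<le>o sup_cardinal R"
      by (rule ordLess_imp_ordLeq)
    then have "|Field s| \<le>o |Field (sup_cardinal R)|"
      by (rule card_of_mono2)
    then obtain f where f: "inj_on f (Field s)" "f ` Field s \<subseteq> Field (sup_cardinal R)"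
      using card_of_ordLeq[of "Field s" "Field (sup_cardinal R)"] by blast
    have iso: "s =o |f ` Field s|"
      by (rule ordIso_transitive[OF ordIso_symmetric[OF card_of_Field_ordIso[OF s]]])
        (rule card_of_ordIsoI[OF inj_on_imp_bij_betw[OF f(1)]])
    then have "|f ` Field s| \<in> ?B"
      using ordLeq_ordIso_trans[OF ub iso] card_of_Card_order by blast
    then have "sup_cardinal R \<le>o |f ` Field s|"
      unfolding sup_cardinal_def by (intro min_cardinal(2)[OF ne]) auto
    then have "sup_cardinal R \<le>o s"
      by (rule ordLeq_ordIso_trans[OF _ ordIso_symmetric[OF iso]])
    then show False
      using \<open>\<not> sup_cardinal R \<le>o s\<close> by blast
  qed
qed

definition cofinality :: "'a set \<Rightarrow> ('a \<Rightarrow> 'a \<Rightarrow> bool) \<Rightarrow> 'a rel" where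
  "cofinality P le = min_cardinal {|C| |C. C \<subseteq> P \<and> (\<forall>p\<in>P. \<exists>c\<in>C. le p c)}"

definition top_density :: "'a topology \<Rightarrow> 'a rel" where
  "top_density T = min_cardinal {|D| |D. D \<subseteq> topspace T \<and> T closure_of D = topspace T}"

text \<open>Neighborhoods are not required to be open.\<close>

definition neighborhoods :: "'a topology \<Rightarrow> 'a \<Rightarrow> 'a set set" where
  "neighborhoods T x = {U. U \<subseteq> topspace T \<and> (\<exists>V. openin T V \<and> x \<in> V \<and> V \<subseteq> U)}"

definition local_density :: "'a topology \<Rightarrow> 'a \<Rightarrow> 'a rel" where
  "local_density T x = min_cardinal {top_density (subtopology T U) |U. U \<in> neighborhoods T x}"

definition precompact_sets :: "'a metric \<Rightarrow> 'a set set" where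
  "precompact_sets X = {S. S \<subseteq> mspace X \<and> Metric_space.mtotally_bounded (mspace X) (mdist X) S}"

definition dominating_number :: "(nat \<Rightarrow> nat) rel" where
  "dominating_number = cofinality UNIV (\<lambda>f g. \<forall>n. f n \<le> g n)"

definition countably_infinite_subsets :: "'a rel \<Rightarrow> 'a set set" where
  "countably_infinite_subsets \<kappa> = {A. A \<subseteq> Field \<kappa> \<and> countable A \<and> infinite A}"

text \<open>
  A completion is a complete metric space together with an isometric embedding with dense image;
  this determines it up to isometry.
\<close>

definition is_completion :: "'a metric \<Rightarrow> 'b metric \<Rightarrow> ('a \<Rightarrow> 'b) \<Rightarrow> bool" where
  "is_completion X Y i \<longleftrightarrow>
     mcomplete_of Y \<and>
     i ` mspace X \<subseteq> mspace Y \<and>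
     (\<forall>x\<in>mspace X. \<forall>y\<in>mspace X. mdist Y (i x) (i y) = mdist X x y) \<and>
     mtopology_of Y closure_of (i ` mspace X) = mspace Y"

lemma completion_exists: "\<exists>(Y :: ('a \<Rightarrow> real) metric) i. is_completion (X :: 'a metric) Y i"
proof -
  interpret Metric_space "mspace X" "mdist X"
    by (rule Metric_space_mspace_mdist)
  show ?thesis
    using metric_completion unfolding is_completion_def image_subset_iff_funcset by metis
qed

end

theory Submission
  imports Defs
begin

text \<open>
  All estimates take place in the completion, where the original space is a dense subset \<open>Y\<close>; an
  isometry carries them back. Write \<open>PK\<close> for the totally bounded subsets of \<open>Y\<close>.

  For the lower bound, \<open>cof PK\<close> is an infinite cardinal, so it suffices to bound each of the three
  factors separately. A totally bounded set is separable, and a cofinal family covers \<open>Y\<close>, so the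
  union of countable dense subsets of its members is dense: this bounds the density
  (\<open>dense_subset_ordLeq_cofinality\<close>). The other two factors come from one source of totally bounded
  sets: if finitely many points are chosen in each ball of radius \<open>1/(n+1)\<close> around a fixed point
  \<open>x\<close>, then all chosen points together form a totally bounded set. A totally bounded set, in turn,
  meets a uniformly separated set in a finite set only. If the completion is not locally compact
  at \<open>x\<close>, every such ball contains an infinite separated sequence, and a function \<open>f\<close> is coded by
  the first \<open>f(n)+1\<close> terms of the sequence in the \<open>n\<close>-th ball
  (\<open>dominating_number_ordLeq_cofinality\<close>). For an arbitrary \<open>x\<close>, every such ball contains a dense
  set which is a countable union of separated sets and has at least \<open>ld(x)\<close> elements. Fix an
  injection \<open>\<phi>\<^sub>n\<close> of \<open>ld(x)\<close> into this set for each \<open>n\<close>. A countable set \<open>{a\<^sub>0, a\<^sub>1, \<dots>}\<close> is coded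
  by the points \<open>\<phi>\<^sub>n(a\<^sub>k)\<close> with \<open>k \<le> n\<close>, and a totally bounded set decodes to a countable one because it
  meets each of the countably many separated sets in a finite set
  (\<open>cofinality_countable_subsets_ordLeq_cofinality\<close>).

  For the upper bound, let \<open>A\<close> be dense in a neighborhood of \<open>x\<close> with \<open>ld(x)\<close> elements. For each \<open>n\<close>,
  a totally bounded subset of the neighborhood is covered by finitely many balls of radius
  \<open>1/(n+1)\<close> centred in \<open>A\<close>. Hence it is described by a countable subset \<open>B\<close> of \<open>A\<close> containing all these
  centres and a function bounding, for each \<open>n\<close>, how far one must go in an enumeration of \<open>B\<close>.
  Enlarging \<open>B\<close> and the function within cofinal families gives at most
  \<open>cof([ld(x)]\<^sup>\<omega>) * \<dd>\<close> totally bounded sets that dominate those inside the neighborhood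
  (\<open>precompact_cover_of_closure\<close>). A base of the completion indexed by a dense set of \<open>Y\<close> allows
  \<open>d(Y)\<close> many neighborhoods to suffice, and by compactness each totally bounded set is a finite
  union of pieces of this local kind (\<open>cofinality_precompact_in_ordLeq_local\<close>).
\<close>

section \<open>Cofinality and density\<close>

lemma cofinal_set_attained:
  assumes "\<And>p. p \<in> P \<Longrightarrow> le p p"
  obtains C where "C \<subseteq> P" and "\<And>p. p \<in> P \<Longrightarrow> \<exists>c\<in>C. le p c" and "|C| = cofinality P le"
proof -
  let ?R = "{|C| |C. C \<subseteq> P \<and> (\<forall>p\<in>P. \<exists>c\<in>C. le p c)}"
  have "min_cardinal ?R \<in> ?R"
  proof (rule min_cardinal(1))
    have "|P| \<in> ?R"
      using assms by blast
    then show "?R \<noteq> {}" by blast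
  qed (use card_of_Card_order in auto)
  then show thesis
    using that unfolding cofinality_def by auto
qed

lemma cofinality_ordLeq_card_of:
  assumes "C \<subseteq> P" and "\<And>p. p \<in> P \<Longrightarrow> \<exists>c\<in>C. le p c"
  shows "cofinality P le \<le>o |C|"
  unfolding cofinality_def using assms card_of_Card_order by (intro min_cardinal(2)) auto

lemma Card_order_cofinality:
  assumes "\<And>p. p \<in> P \<Longrightarrow> le p p"
  shows "Card_order (cofinality P le)"
  using cofinal_set_attained[of P le] assms card_of_Card_order by metis

text \<open>
  A cofinal family in \<open>Q\<close> is pushed to one in \<open>P\<close> by \<open>h\<close>. The element \<open>q\<close> codes \<open>p\<close>, and anything above
  the code decodes to something above \<open>p\<close>. Only decodings above a code have to land in \<open>P\<close>, since
  members of the image outside \<open>P\<close> can be discarded.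
\<close>

lemma cofinality_ordLeq_Tukey:
  assumes refl: "\<And>q. q \<in> Q \<Longrightarrow> le' q q"
    and tukey: "\<And>p. p \<in> P \<Longrightarrow> \<exists>q\<in>Q. \<forall>q'\<in>Q. le' q q' \<longrightarrow> h q' \<in> P \<and> le p (h q')"
  shows "cofinality P le \<le>o cofinality Q le'"
proof -
  obtain C where C: "C \<subseteq> Q" "\<And>q. q \<in> Q \<Longrightarrow> \<exists>c\<in>C. le' q c" "|C| = cofinality Q le'"
    using cofinal_set_attained[of Q le'] refl by metis
  have "cofinality P le \<le>o |h ` C \<inter> P|"
  proof (rule cofinality_ordLeq_card_of)
    fix p assume "p \<in> P"
    then obtain q where q: "q \<in> Q" "\<forall>q'\<in>Q. le' q q' \<longrightarrow> h q' \<in> P \<and> le p (h q')"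
      using tukey by blast
    obtain c where "c \<in> C" "le' q c"
      using C(2) q(1) by blast
    then show "\<exists>c\<in>h ` C \<inter> P. le p c"
      using q C(1) by blast
  qed simp
  also have "|h ` C \<inter> P| \<le>o |h ` C|"
    by (rule card_of_mono1) blast
  also have "|h ` C| \<le>o |C|"
    by (rule card_of_image)
  finally show ?thesis
    unfolding C(3) .
qed

lemma dense_set_attained:
  obtains D where "D \<subseteq> topspace T" and "T closure_of D = topspace T" and "|D| = top_density T"
proof -
  let ?R = "{|D| |D. D \<subseteq> topspace T \<and> T closure_of D = topspace T}"
  have "min_cardinal ?R \<in> ?R"
  proof (rule min_cardinal(1))
    have "|topspace T| \<in> ?R"
      by (intro CollectI exI[of _ "topspace T"]) simp
    then show "?R \<noteq> {}" by blast
  qed (use card_of_Card_order in auto)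
  then show thesis
    using that unfolding top_density_def by auto
qed

lemma top_density_ordLeq_card_of:
  assumes "D \<subseteq> topspace T" and "T closure_of D = topspace T"
  shows "top_density T \<le>o |D|"
  unfolding top_density_def
proof (rule min_cardinal(2))
  let ?R = "{|D| |D. D \<subseteq> topspace T \<and> T closure_of D = topspace T}"
  show "|D| \<in> ?R"
    using assms by blast
  then show "?R \<noteq> {}" by blast
  show "Card_order r" if "r \<in> ?R" for r
    using that card_of_Card_order by blast
qed

lemma Card_order_top_density: "Card_order (top_density T)"
proof -
  obtain D where "D \<subseteq> topspace T" "T closure_of D = topspace T" "|D| = top_density T"
    by (rule dense_set_attained)
  then show ?thesis
    using card_of_Card_order[of D] by simp
qed

lemma local_density_attained:
  assumes "x \<in> topspace T"
  obtains U D where "U \<in> neighborhoods T x" and "D \<subseteq> U" and "U \<subseteq> T closure_of D"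
    and "|D| = local_density T x"
proof -
  let ?R = "{top_density (subtopology T U) |U. U \<in> neighborhoods T x}"
  have "min_cardinal ?R \<in> ?R"
  proof (rule min_cardinal(1))
    have "topspace T \<in> neighborhoods T x"
      unfolding neighborhoods_def using assms by blast
    then show "?R \<noteq> {}" by blast
  qed (use Card_order_top_density in blast)
  then obtain U where U: "U \<in> neighborhoods T x" "local_density T x = top_density (subtopology T U)"
    unfolding local_density_def by auto
  have sub: "U \<subseteq> topspace T"
    using U(1) unfolding neighborhoods_def by blast
  obtain D where D: "D \<subseteq> topspace (subtopology T U)"
    "subtopology T U closure_of D = topspace (subtopology T U)"
    "|D| = top_density (subtopology T U)"
    by (rule dense_set_attained)
  have "D \<subseteq> U"
    using D(1) by simp
  moreover have "U \<subseteq> T closure_of D"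
    using D(2) sub \<open>D \<subseteq> U\<close> by (simp add: closure_of_subtopology Int_absorb1) blast
  ultimately show thesis
    using that[OF U(1)] D(3) U(2) by simp
qed

lemma local_density_ordLeq:
  assumes "openin T U" and "x \<in> U" and "D \<subseteq> U" and "U \<subseteq> T closure_of D"
  shows "local_density T x \<le>o |D|"
proof -
  have sub: "U \<subseteq> topspace T"
    using assms(1) by (rule openin_subset)
  have "local_density T x \<le>o top_density (subtopology T U)"
    unfolding local_density_def
  proof (rule min_cardinal(2))
    have "U \<in> neighborhoods T x"
      unfolding neighborhoods_def using assms sub by blast
    then show *: "top_density (subtopology T U) \<in> {top_density (subtopology T U) |U. U \<in> neighborhoods T x}"
      by blast
    then show "{top_density (subtopology T U) |U. U \<in> neighborhoods T x} \<noteq> {}"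
      by blast
  qed (use Card_order_top_density in blast)
  also have "top_density (subtopology T U) \<le>o |D|"
    using assms sub
    by (intro top_density_ordLeq_card_of) (auto simp: closure_of_subtopology Int_absorb1)
  finally show ?thesis .
qed

lemma nat_ordLeq_Cinfinite: "Cinfinite r \<Longrightarrow> |UNIV :: nat set| \<le>o r"
  unfolding cinfinite_def
  using infinite_iff_card_of_nat card_of_Field_ordIso ordLeq_ordIso_trans by blast

lemma ordLeq_cprod_left: "Card_order p \<Longrightarrow> Cnotzero q \<Longrightarrow> p \<le>o p *c q"
  by (rule ordLeq_ordIso_trans[OF ordLeq_cprod2 cprod_com])

lemma card_of_finite_Unions:
  fixes r :: "'c rel"
  assumes r: "Cinfinite r" and \<U>: "|\<U>| \<le>o r"
  shows "|{\<Union>\<F> |\<F>. finite \<F> \<and> \<F> \<subseteq> \<U>}| \<le>o r"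
proof -
  \<comment> \<open>\<open>L n\<close> consists of the unions of \<open>n\<close> members, repetitions allowed; each step multiplies the
    cardinality by at most \<open>r\<close>.\<close>
  define L where "L = rec_nat {{}} (\<lambda>_ L. (\<lambda>(A, B). A \<union> B) ` (\<U> \<times> L))"
  have L0: "L 0 = {{}}" and LSuc: "L (Suc n) = (\<lambda>(A, B). A \<union> B) ` (\<U> \<times> L n)" for n
    unfolding L_def by simp_all
  have rF: "infinite (Field r)" and rC: "Card_order r"
    using r by (auto simp: cinfinite_def)
  have card: "|L n| \<le>o r" for n
  proof (induction n)
    case 0
    show ?case
      unfolding L0 using rF rC by (intro Card_order_singl_ordLeq) auto
  next
    case (Suc n)
    have "|L (Suc n)| \<le>o |\<U> \<times> L n|"
      unfolding LSuc by (rule card_of_image)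
    also have "|\<U> \<times> L n| \<le>o r"
      by (rule card_of_Times_ordLeq_infinite_Field[OF rF \<U> Suc.IH rC])
    finally show ?case .
  qed
  have "\<exists>n. \<Union>\<F> \<in> L n" if "finite \<F>" "\<F> \<subseteq> \<U>" for \<F>
    using that
  proof (induction \<F>)
    case empty
    then show ?case using L0 by auto
  next
    case (insert A \<F>)
    then obtain n where "\<Union>\<F> \<in> L n" by auto
    then have "\<Union>(insert A \<F>) \<in> L (Suc n)"
      unfolding LSuc using insert.prems by auto
    then show ?case ..
  qed
  then have "|{\<Union>\<F> |\<F>. finite \<F> \<and> \<F> \<subseteq> \<U>}| \<le>o |\<Union>n. L n|"
    by (intro card_of_mono1) auto
  also have "|\<Union>n. L n| \<le>o r"
    using card nat_ordLeq_Cinfinite[OF r] rF rC by (intro card_of_UNION_ordLeq_infinite_Field) auto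
  finally show ?thesis .
qed

lemma countable_ordLeq_infinite: "countable A \<Longrightarrow> infinite B \<Longrightarrow> |A| \<le>o |B|"
  unfolding countable_def
  using card_of_ordLeq[of A "UNIV :: nat set"] infinite_iff_card_of_nat ordLeq_transitive by blast

section \<open>Total boundedness and separated sets\<close>

context Metric_space
begin

text \<open>
  Centres outside the set are moved into it at the cost of doubling the radius.
\<close>

lemma mtotally_bounded_outer_centres:
  assumes "S \<subseteq> M"
    and cov: "\<And>\<epsilon>. 0 < \<epsilon> \<Longrightarrow> \<exists>K. finite K \<and> S \<subseteq> (\<Union>x\<in>K. mball x \<epsilon>)"
  shows "mtotally_bounded S"
  unfolding mtotally_bounded_def
proof (intro allI impI)
  fix \<epsilon> :: real assume "0 < \<epsilon>"
  then obtain K where K: "finite K" "S \<subseteq> (\<Union>x\<in>K. mball x (\<epsilon>/2))"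
    using cov[of "\<epsilon>/2"] by auto
  let ?K = "{x \<in> K. S \<inter> mball x (\<epsilon>/2) \<noteq> {}}"
  have "\<forall>x\<in>?K. \<exists>y. y \<in> S \<inter> mball x (\<epsilon>/2)"
    by blast
  from bchoice[OF this] obtain c where "\<forall>x\<in>?K. c x \<in> S \<inter> mball x (\<epsilon>/2)" ..
  then have c: "c x \<in> S \<inter> mball x (\<epsilon>/2)" if "x \<in> ?K" for x
    using that by (rule bspec)
  have "S \<subseteq> (\<Union>x\<in>c ` ?K. mball x \<epsilon>)"
  proof
    fix z assume "z \<in> S"
    then obtain x where x: "x \<in> K" "z \<in> mball x (\<epsilon>/2)"
      using K(2) by blast
    then have "x \<in> ?K"
      using \<open>z \<in> S\<close> by blast
    have mem: "c x \<in> M" "x \<in> M" "z \<in> M" and lt: "d x (c x) < \<epsilon>/2" "d x z < \<epsilon>/2"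
      using c[OF \<open>x \<in> ?K\<close>] x(2) by auto
    have "d (c x) z \<le> d x (c x) + d x z"
      using triangle[of "c x" x z] mem by (simp add: commute)
    then have "z \<in> mball (c x) \<epsilon>"
      using lt mem by simp
    then show "z \<in> (\<Union>x\<in>c ` ?K. mball x \<epsilon>)"
      using \<open>x \<in> ?K\<close> by blast
  qed
  then show "\<exists>K. finite K \<and> K \<subseteq> S \<and> S \<subseteq> (\<Union>x\<in>K. mball x \<epsilon>)"
    using K(1) c by (intro exI[of _ "c ` ?K"]) auto
qed

text \<open>
  The finite sets converge to \<open>x\<close>, so a ball around \<open>x\<close> contains all but finitely many of their
  points. All totally bounded sets constructed for the lower bounds have this form.
\<close>

lemma mtotally_bounded_convergent_finite_sets:
  assumes "x \<in> M" and fin: "\<And>n. finite (A n)" and sub: "\<And>n. A n \<subseteq> mball x (inverse (Suc n))"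
  shows "mtotally_bounded (\<Union>n. A n)"
proof (rule mtotally_bounded_outer_centres)
  show AM: "(\<Union>n. A n) \<subseteq> M"
    using sub by fastforce
  fix \<epsilon> :: real assume "0 < \<epsilon>"
  then obtain N where N: "inverse (Suc N) < \<epsilon>"
    using reals_Archimedean by blast
  have "A n \<subseteq> (\<Union>y\<in>insert x (\<Union>n<N. A n). mball y \<epsilon>)" for n
  proof (cases "n < N")
    case True
    have "y \<in> mball y \<epsilon>" if "y \<in> A n" for y
      using that AM \<open>0 < \<epsilon>\<close> by (intro centre_in_mball_iff[THEN iffD2]) auto
    then show ?thesis
      using True by blast
  next
    case False
    then have "inverse (real (Suc n)) \<le> inverse (Suc N)"
      by (simp add: le_imp_inverse_le)
    then have "mball x (inverse (Suc n)) \<subseteq> mball x \<epsilon>"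
      using N by (intro mball_subset_concentric) linarith
    then show ?thesis
      using sub[of n] by blast
  qed
  then have "(\<Union>n. A n) \<subseteq> (\<Union>y\<in>insert x (\<Union>n<N. A n). mball y \<epsilon>)"
    by (rule UN_least)
  moreover have "finite (insert x (\<Union>n<N. A n))"
    using fin by simp
  ultimately show "\<exists>K. finite K \<and> (\<Union>n. A n) \<subseteq> (\<Union>x\<in>K. mball x \<epsilon>)"
    by blast
qed

text \<open>
  A ball of radius \<open>\<epsilon>\<close> centred at a point of \<open>S\<close> contains no other point of \<open>S\<close>. This finiteness is what
  makes decoding possible in the lower bounds.
\<close>

lemma finite_mtotally_bounded_Int_separated:
  assumes "mtotally_bounded K" and "0 < \<epsilon>" and sep: "pairwise (\<lambda>x y. \<epsilon> \<le> d x y) S"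
  shows "finite (K \<inter> S)"
proof -
  have "mtotally_bounded (K \<inter> S)"
    using assms(1) mtotally_bounded_subset by blast
  then obtain F where F: "finite F" "F \<subseteq> K \<inter> S" "K \<inter> S \<subseteq> (\<Union>x\<in>F. mball x \<epsilon>)"
    unfolding mtotally_bounded_def using \<open>0 < \<epsilon>\<close> by metis
  have "K \<inter> S \<subseteq> F"
  proof
    fix y assume y: "y \<in> K \<inter> S"
    then obtain x where x: "x \<in> F" "d x y < \<epsilon>"
      using F(3) by auto
    then have "x = y"
      using sep y F(2) unfolding pairwise_def by force
    then show "y \<in> F"
      using x by simp
  qed
  then show ?thesis
    using F(1) finite_subset by blast
qed

lemma maximal_separated_subset:
  assumes "S \<subseteq> M" and "0 < \<epsilon>"
  obtains E where "E \<subseteq> S" and "pairwise (\<lambda>x y. \<epsilon> \<le> d x y) E" and "S \<subseteq> (\<Union>x\<in>E. mball x \<epsilon>)"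
proof -
  let ?A = "{E. E \<subseteq> S \<and> pairwise (\<lambda>x y. \<epsilon> \<le> d x y) E}"
  have "\<exists>E\<in>?A. \<forall>X\<in>?A. E \<subseteq> X \<longrightarrow> X = E"
  proof (rule subset_Zorn')
    fix C assume C: "subset.chain ?A C"
    have "pairwise (\<lambda>x y. \<epsilon> \<le> d x y) (\<Union>C)"
      using C by (intro pairwise_chain_Union) (auto simp: subset_chain_def chain_subset_def)
    then show "\<Union>C \<in> ?A"
      using C by (auto simp: subset_chain_def)
  qed
  then obtain E where "E \<in> ?A" and "\<forall>X\<in>?A. E \<subseteq> X \<longrightarrow> X = E" ..
  then have E: "E \<subseteq> S" "pairwise (\<lambda>x y. \<epsilon> \<le> d x y) E"
    and max: "\<And>X. X \<subseteq> S \<Longrightarrow> pairwise (\<lambda>x y. \<epsilon> \<le> d x y) X \<Longrightarrow> E \<subseteq> X \<Longrightarrow> X = E"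
    by simp_all
  have "S \<subseteq> (\<Union>x\<in>E. mball x \<epsilon>)"
  proof
    fix z assume z: "z \<in> S"
    show "z \<in> (\<Union>x\<in>E. mball x \<epsilon>)"
    proof (rule ccontr)
      assume *: "z \<notin> (\<Union>x\<in>E. mball x \<epsilon>)"
      then have far: "\<epsilon> \<le> d x z" if "x \<in> E" for x
        using that z E(1) \<open>S \<subseteq> M\<close> by force
      have "pairwise (\<lambda>x y. \<epsilon> \<le> d x y) (insert z E)"
        using E(2) far by (auto simp: pairwise_insert commute)
      then have "insert z E = E"
        using max z E(1) by blast
      then have "z \<in> E" by blast
      moreover have "z \<in> mball z \<epsilon>"
        using z \<open>S \<subseteq> M\<close> \<open>0 < \<epsilon>\<close> by (intro centre_in_mball_iff[THEN iffD2]) auto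
      ultimately show False
        using * by blast
    qed
  qed
  then show thesis
    using that E by blast
qed

text \<open>
  At a scale where no finite net exists, a maximal separated subset is a net and so cannot be finite.
\<close>

lemma infinite_separated_subset:
  assumes "S \<subseteq> M" and "\<not> mtotally_bounded S"
  obtains \<epsilon> E where "0 < \<epsilon>" and "E \<subseteq> S" and "infinite E" and "pairwise (\<lambda>x y. \<epsilon> \<le> d x y) E"
proof -
  obtain \<epsilon> where \<epsilon>: "0 < \<epsilon>" "\<nexists>K. finite K \<and> K \<subseteq> S \<and> S \<subseteq> (\<Union>x\<in>K. mball x \<epsilon>)"
    using assms(2) unfolding mtotally_bounded_def not_all not_imp by (elim exE conjE)
  obtain E where E: "E \<subseteq> S" "pairwise (\<lambda>x y. \<epsilon> \<le> d x y) E" "S \<subseteq> (\<Union>x\<in>E. mball x \<epsilon>)"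
    by (rule maximal_separated_subset[OF assms(1) \<epsilon>(1)])
  have "infinite E"
  proof
    assume "finite E"
    then have "finite E \<and> E \<subseteq> S \<and> S \<subseteq> (\<Union>x\<in>E. mball x \<epsilon>)"
      using E by simp
    with \<epsilon>(2) show False by (rule notE[OF _ exI])
  qed
  then show thesis
    by (rule that[OF \<epsilon>(1) E(1) _ E(2)])
qed

text \<open>
  Maximal separated subsets at the scales \<open>1/(m+1)\<close> are finer and finer nets, so their union is dense.
  Keeping the dense set in this stratified form ensures that a totally bounded set meets it in a
  countable set only.
\<close>

lemma sigma_separated_dense_subset:
  assumes "S \<subseteq> M"
  obtains E :: "nat \<Rightarrow> 'a set" where "\<And>m. E m \<subseteq> S"
    and "\<And>m. pairwise (\<lambda>x y. inverse (Suc m) \<le> d x y) (E m)"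
    and "S \<subseteq> mtopology closure_of (\<Union>m. E m)"
proof -
  have "\<exists>E. E \<subseteq> S \<and> pairwise (\<lambda>x y. inverse (Suc m) \<le> d x y) E
      \<and> S \<subseteq> (\<Union>x\<in>E. mball x (inverse (Suc m)))" for m
    using maximal_separated_subset[OF assms, of "inverse (Suc m)"] by (metis inverse_Suc)
  then obtain E :: "nat \<Rightarrow> 'a set" where E: "\<And>m. E m \<subseteq> S"
    "\<And>m. pairwise (\<lambda>x y. inverse (Suc m) \<le> d x y) (E m)"
    "\<And>m. S \<subseteq> (\<Union>x\<in>E m. mball x (inverse (Suc m)))"
    by metis
  have "S \<subseteq> mtopology closure_of (\<Union>m. E m)"
    unfolding metric_closure_of
  proof (intro subsetI CollectI conjI allI impI)
    fix z assume z: "z \<in> S"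
    show "z \<in> M" using z assms by blast
    fix r :: real assume "0 < r"
    obtain m where m: "inverse (Suc m) < r"
      using \<open>0 < r\<close> reals_Archimedean by blast
    obtain y where "y \<in> E m" "z \<in> mball y (inverse (Suc m))"
      using E(3) z by blast
    then show "\<exists>y\<in>\<Union>m. E m. y \<in> mball z r"
      using m by (force simp: commute)
  qed
  then show thesis
    using that E by blast
qed

text \<open>
  Total boundedness of a set is measured in the ambient space, so that \<open>Y\<close> can stand for the original
  space inside its completion.
\<close>

definition precompact_in :: "'a set \<Rightarrow> 'a set set" where
  "precompact_in Y = {S. S \<subseteq> Y \<and> mtotally_bounded S}"

text \<open>
  In a complete space the closure of a totally bounded set is compact, and the closure of \<open>Y \<inter> U\<close>
  contains \<open>U\<close> for open \<open>U\<close>. If every \<open>x\<close> had a ball with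
  \<open>Y \<inter> mball x r\<close> totally bounded, compact neighborhoods would exist everywhere.
\<close>

lemma non_locally_compact_point:
  assumes "mcomplete" and dense: "mtopology closure_of Y = M"
    and "\<not> locally_compact_space mtopology"
  obtains x where "x \<in> M" and "\<And>r. 0 < r \<Longrightarrow> \<not> mtotally_bounded (Y \<inter> mball x r)"
proof -
  have "\<exists>x\<in>M. \<forall>r>0. \<not> mtotally_bounded (Y \<inter> mball x r)"
  proof (rule ccontr)
    assume "\<not> ?thesis"
    then have *: "\<exists>r>0. mtotally_bounded (Y \<inter> mball x r)" if "x \<in> M" for x
      using that by blast
    have "locally_compact_space mtopology"
      unfolding locally_compact_space_def
    proof
      fix x assume "x \<in> topspace mtopology"
      then have "x \<in> M" by simp
      then obtain r where r: "0 < r" "mtotally_bounded (Y \<inter> mball x r)"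
        using * by blast
      have "mball x r \<inter> mtopology closure_of Y \<subseteq> mtopology closure_of (mball x r \<inter> Y)"
        by (rule openin_Int_closure_of_subset) simp
      then have "mball x r \<subseteq> mtopology closure_of (Y \<inter> mball x r)"
        using dense mball_subset_mspace by (simp add: Int_commute) blast
      moreover have "compactin mtopology (mtopology closure_of (Y \<inter> mball x r))"
        using r(2) mtotally_bounded_eq_compact_closure_of[OF \<open>mcomplete\<close>] by blast
      ultimately show "\<exists>U K. openin mtopology U \<and> compactin mtopology K \<and> x \<in> U \<and> U \<subseteq> K"
        using \<open>x \<in> M\<close> r(1) by (intro exI[of _ "mball x r"] exI conjI) auto
    qed
    then show False
      using assms(3) by blast
  qed
  then show thesis
    using that by blast
qed

section \<open>Lower bounds\<close>

text \<open>
  With an infinite separated sequence \<open>a n\<close> in the \<open>n\<close>-th ball around \<open>x\<close>, initial segments of the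
  sequences code functions: \<open>f\<close> becomes the totally bounded set of all \<open>a n m\<close> with \<open>m \<le> f n\<close>, and
  a totally bounded set \<open>K\<close> decodes to the function sending \<open>n\<close> to the last \<open>m\<close> with \<open>a n m \<in> K\<close>.
\<close>

lemma dominating_number_ordLeq_cofinality:
  assumes "x \<in> M" and YM: "Y \<subseteq> M" and ntb: "\<And>r. 0 < r \<Longrightarrow> \<not> mtotally_bounded (Y \<inter> mball x r)"
  shows "dominating_number \<le>o cofinality (precompact_in Y) (\<subseteq>)"
proof -
  have "\<exists>a :: nat \<Rightarrow> 'a. \<exists>\<epsilon>>0. inj a \<and> range a \<subseteq> Y \<inter> mball x (inverse (Suc n))
      \<and> pairwise (\<lambda>x y. \<epsilon> \<le> d x y) (range a)" for n
  proof -
    obtain \<epsilon> E where E: "0 < \<epsilon>" "E \<subseteq> Y \<inter> mball x (inverse (Suc n))" "infinite E"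
      "pairwise (\<lambda>x y. \<epsilon> \<le> d x y) E"
      using infinite_separated_subset[of "Y \<inter> mball x (inverse (Suc n))"] YM ntb[of "inverse (Suc n)"]
      by (metis inf.coboundedI1 inverse_Suc)
    obtain a :: "nat \<Rightarrow> 'a" where "inj a" "range a \<subseteq> E"
      using infinite_countable_subset[OF E(3)] by blast
    then show ?thesis
      using E pairwise_subset by (intro exI[of _ a] exI[of _ \<epsilon>]) blast
  qed
  then obtain a :: "nat \<Rightarrow> nat \<Rightarrow> 'a" and \<epsilon> where a: "\<And>n. 0 < \<epsilon> n" "\<And>n. inj (a n)"
    "\<And>n. range (a n) \<subseteq> Y \<inter> mball x (inverse (Suc n))"
    "\<And>n. pairwise (\<lambda>x y. \<epsilon> n \<le> d x y) (range (a n))"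
    by metis
  show ?thesis
    unfolding dominating_number_def
  proof (rule cofinality_ordLeq_Tukey[where h = "\<lambda>K n. Max {m. a n m \<in> K}"])
    fix f :: "nat \<Rightarrow> nat"
    let ?A = "\<Union>n. a n ` {..f n}"
    have img: "a n ` {..f n} \<subseteq> Y \<inter> mball x (inverse (Suc n))" for n
      using a(3)[of n] by blast
    have "mtotally_bounded ?A"
      using img by (intro mtotally_bounded_convergent_finite_sets[OF \<open>x \<in> M\<close>]) auto
    then have "?A \<in> precompact_in Y"
      unfolding precompact_in_def using img by blast
    moreover have "f n \<le> Max {m. a n m \<in> K}" if K: "K \<in> precompact_in Y" "?A \<subseteq> K" for K n
    proof (rule Max_ge)
      have "finite (K \<inter> range (a n))"
        using K(1) a(1,4) finite_mtotally_bounded_Int_separated unfolding precompact_in_def by blast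
      then have "finite (a n -` (K \<inter> range (a n)))"
        using a(2) by (intro finite_vimageI)
      then show "finite {m. a n m \<in> K}"
        by (rule finite_subset[rotated]) auto
      show "f n \<in> {m. a n m \<in> K}"
        using K(2) by blast
    qed
    ultimately show "\<exists>q\<in>precompact_in Y. \<forall>q'\<in>precompact_in Y. q \<subseteq> q' \<longrightarrow>
        (\<lambda>n. Max {m. a n m \<in> q'}) \<in> UNIV \<and> (\<forall>n. f n \<le> Max {m. a n m \<in> q'})"
      by blast
  qed simp
qed

text \<open>
  Finite unions of totally bounded sets are totally bounded, and singletons force a cofinal family
  to cover \<open>Y\<close>.
\<close>

lemma infinite_cofinal_family:
  assumes "Y \<subseteq> M" and ntb: "\<not> mtotally_bounded Y"
    and C: "\<C> \<subseteq> precompact_in Y" "\<And>S. S \<in> precompact_in Y \<Longrightarrow> \<exists>K\<in>\<C>. S \<subseteq> K"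
  shows "infinite \<C>"
proof
  assume "finite \<C>"
  then have "mtotally_bounded (\<Union>\<C>)"
    using C(1) unfolding precompact_in_def by (intro mtotally_bounded_Union) auto
  moreover have "Y \<subseteq> \<Union>\<C>"
  proof
    fix y assume "y \<in> Y"
    then have "{y} \<in> precompact_in Y"
      using assms(1) unfolding precompact_in_def by auto
    then show "y \<in> \<Union>\<C>"
      using C(2) by blast
  qed
  ultimately show False
    using ntb mtotally_bounded_subset by blast
qed

text \<open>
  Finite nets at all scales of all members of a cofinal family form a dense set. Each member
  contributes countably many points, which does not increase an infinite cardinal.
\<close>

lemma dense_subset_ordLeq_cofinality:
  assumes "Y \<subseteq> M" and dense: "mtopology closure_of Y = M" and ntb: "\<not> mtotally_bounded Y"
  obtains D where "D \<subseteq> Y" and "mtopology closure_of D = M"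
    and "|D| \<le>o cofinality (precompact_in Y) (\<subseteq>)"
proof -
  obtain \<C> where \<C>: "\<C> \<subseteq> precompact_in Y" "\<And>S. S \<in> precompact_in Y \<Longrightarrow> \<exists>K\<in>\<C>. S \<subseteq> K"
    "|\<C>| = cofinality (precompact_in Y) (\<subseteq>)"
    using cofinal_set_attained[of "precompact_in Y" "(\<subseteq>)"] by blast
  have inf: "infinite \<C>"
    using infinite_cofinal_family[OF assms(1) ntb] \<C> by blast
  have "\<exists>F. finite F \<and> F \<subseteq> K \<and> K \<subseteq> (\<Union>x\<in>F. mball x (inverse (Suc n)))" if "K \<in> \<C>" for K n
  proof -
    have "mtotally_bounded K"
      using that \<C>(1) unfolding precompact_in_def by blast
    then have "\<forall>\<epsilon>>0. \<exists>F. finite F \<and> F \<subseteq> K \<and> K \<subseteq> (\<Union>x\<in>F. mball x \<epsilon>)"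
      unfolding mtotally_bounded_def .
    from spec[OF this, of "inverse (real (Suc n))"] show ?thesis
      by simp
  qed
  then obtain F where F: "\<And>K n. K \<in> \<C> \<Longrightarrow> finite (F K n)" "\<And>K n. K \<in> \<C> \<Longrightarrow> F K n \<subseteq> K"
    "\<And>K n. K \<in> \<C> \<Longrightarrow> K \<subseteq> (\<Union>x\<in>F K n. mball x (inverse (Suc n)))"
    by metis
  define D where "D = (\<Union>K\<in>\<C>. \<Union>n. F K n)"
  have DY: "D \<subseteq> Y"
    using F(2) \<C>(1) unfolding D_def precompact_in_def by blast
  have "|D| \<le>o |\<C>|"
    unfolding D_def
  proof (rule card_of_UNION_ordLeq_infinite[OF inf])
    show "\<forall>K\<in>\<C>. |\<Union>n. F K n| \<le>o |\<C>|"
      using F(1) inf by (intro ballI countable_ordLeq_infinite countable_UN) (auto intro: countable_finite)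
  qed (rule card_of_mono1[OF order_refl])
  moreover have "Y \<subseteq> mtopology closure_of D"
    unfolding metric_closure_of
  proof (intro subsetI CollectI conjI allI impI)
    fix y assume y: "y \<in> Y"
    show "y \<in> M" using y assms(1) by blast
    fix r :: real assume "0 < r"
    have "{y} \<in> precompact_in Y"
      using y assms(1) unfolding precompact_in_def by auto
    then obtain K where K: "K \<in> \<C>" "y \<in> K"
      using \<C>(2) by blast
    obtain n where n: "inverse (Suc n) < r"
      using \<open>0 < r\<close> reals_Archimedean by blast
    obtain z where "z \<in> F K n" "y \<in> mball z (inverse (Suc n))"
      using F(3)[OF K(1)] K(2) by blast
    then show "\<exists>z\<in>D. z \<in> mball y r"
      using n K(1) unfolding D_def by (force simp: commute)
  qed
  then have "mtopology closure_of D = M"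
    using dense closure_of_mono[of Y "mtopology closure_of D" mtopology]
      closure_of_subset_topspace[of mtopology D] by auto
  ultimately show thesis
    using that DY \<C>(3) by simp
qed

text \<open>
  A countable set \<open>A\<close> may be infinite, while only finitely many points may be placed in each ball. The
  way out is to use copies of the local density in all balls and to delay: the \<open>k\<close>-th element of \<open>A\<close> is
  placed only in the balls with index \<open>n \<ge> k\<close>. Decoding reads the elements off all copies at once.
\<close>

lemma cofinality_countable_subsets_ordLeq_cofinality:
  assumes "x \<in> M" and "Y \<subseteq> M" and dense: "mtopology closure_of Y = M"
  shows "cofinality (countably_infinite_subsets (local_density mtopology x)) (\<subseteq>)
    \<le>o cofinality (precompact_in Y) (\<subseteq>)"
proof -
  have "x \<in> topspace mtopology"
    using assms(1) by simp
  then obtain W L where "W \<in> neighborhoods mtopology x" "L \<subseteq> W" "W \<subseteq> mtopology closure_of L"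
    and L: "|L| = local_density mtopology x"
    by (rule local_density_attained)
  have "\<exists>\<phi> E. (\<forall>m. E m \<subseteq> Y \<inter> mball x (inverse (Suc n)))
      \<and> (\<forall>m. pairwise (\<lambda>x y. inverse (Suc m) \<le> d x y) (E m))
      \<and> inj_on \<phi> L \<and> \<phi> ` L \<subseteq> (\<Union>m::nat. E m)" for n
  proof -
    let ?B = "mball x (inverse (Suc n))"
    obtain E where E: "\<And>m::nat. E m \<subseteq> Y \<inter> ?B"
      "\<And>m. pairwise (\<lambda>x y. inverse (Suc m) \<le> d x y) (E m)"
      "Y \<inter> ?B \<subseteq> mtopology closure_of (\<Union>m. E m)"
      using sigma_separated_dense_subset[of "Y \<inter> ?B"] assms(2) by blast
    have "?B \<inter> mtopology closure_of Y \<subseteq> mtopology closure_of (?B \<inter> Y)"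
      by (rule openin_Int_closure_of_subset) simp
    also have "\<dots> \<subseteq> mtopology closure_of (\<Union>m. E m)"
      using E(3) by (intro closure_of_minimal) (auto simp: Int_commute)
    finally have "?B \<subseteq> mtopology closure_of (\<Union>m. E m)"
      using dense mball_subset_mspace by blast
    then have "local_density mtopology x \<le>o |\<Union>m. E m|"
      using E(1) \<open>x \<in> M\<close> by (intro local_density_ordLeq[of _ ?B]) auto
    then obtain \<phi> where "inj_on \<phi> L" "\<phi> ` L \<subseteq> (\<Union>m. E m)"
      using card_of_ordLeq[of L "\<Union>m. E m"] L by metis
    then show ?thesis
      using E by blast
  qed
  then obtain \<phi> :: "nat \<Rightarrow> 'a \<Rightarrow> 'a" and E :: "nat \<Rightarrow> nat \<Rightarrow> 'a set"
    where E: "\<And>n m. E n m \<subseteq> Y \<inter> mball x (inverse (Suc n))"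
      "\<And>n m. pairwise (\<lambda>x y. inverse (Suc m) \<le> d x y) (E n m)"
      and \<phi>: "\<And>n. inj_on (\<phi> n) L" "\<And>n. \<phi> n ` L \<subseteq> (\<Union>m. E n m)"
    by metis
  define h where "h K = {\<alpha> \<in> L. \<exists>n. \<phi> n \<alpha> \<in> K}" for K
  have countable_h: "countable (h K)" if "K \<in> precompact_in Y" for K
  proof -
    have "countable {\<alpha> \<in> L. \<phi> n \<alpha> \<in> K}" for n
    proof (rule countable_image_inj_on)
      have "finite (K \<inter> E n m)" for m
        using that E(2)[of m n] finite_mtotally_bounded_Int_separated[of K "inverse (Suc m)"]
        unfolding precompact_in_def by (simp del: of_nat_Suc)
      then have "countable (\<Union>m. K \<inter> E n m)"
        by (intro countable_UN) (auto intro: countable_finite)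
      then show "countable (\<phi> n ` {\<alpha> \<in> L. \<phi> n \<alpha> \<in> K})"
        by (rule countable_subset[rotated]) (use \<phi>(2)[of n] in blast)
      show "inj_on (\<phi> n) {\<alpha> \<in> L. \<phi> n \<alpha> \<in> K}"
        using \<phi>(1)[of n] by (rule inj_on_subset) blast
    qed
    moreover have "h K = (\<Union>n. {\<alpha> \<in> L. \<phi> n \<alpha> \<in> K})"
      unfolding h_def by blast
    ultimately show ?thesis
      by simp
  qed
  show ?thesis
    unfolding L[symmetric]
  proof (rule cofinality_ordLeq_Tukey[where h = h])
    fix A assume "A \<in> countably_infinite_subsets |L|"
    then have A: "A \<subseteq> L" "countable A" "infinite A"
      unfolding countably_infinite_subsets_def by (auto simp: Field_card_of)
    let ?a = "from_nat_into A"
    have a: "range ?a = A"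
      using A by (intro range_from_nat_into) auto
    let ?K = "\<Union>n. \<phi> n ` ?a ` {..n}"
    have img: "\<phi> n ` ?a ` {..n} \<subseteq> Y \<inter> mball x (inverse (Suc n))" for n
      using a A(1) \<phi>(2)[of n] E(1)[of n] by blast
    have "?K \<in> precompact_in Y"
      unfolding precompact_in_def using img mtotally_bounded_convergent_finite_sets[OF \<open>x \<in> M\<close>]
      by auto
    moreover have "h K \<in> countably_infinite_subsets |L| \<and> A \<subseteq> h K"
      if K: "K \<in> precompact_in Y" "?K \<subseteq> K" for K
    proof -
      have "A \<subseteq> h K"
      proof
        fix \<alpha> assume "\<alpha> \<in> A"
        then obtain n where "\<alpha> = ?a n"
          using a by blast
        then show "\<alpha> \<in> h K"
          unfolding h_def using K(2) A(1) \<open>\<alpha> \<in> A\<close> by blast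
      qed
      then show ?thesis
        using countable_h[OF K(1)] A(3) finite_subset
        unfolding countably_infinite_subsets_def by (auto simp: Field_card_of h_def)
    qed
    ultimately show "\<exists>q\<in>precompact_in Y. \<forall>q'\<in>precompact_in Y. q \<subseteq> q' \<longrightarrow>
        h q' \<in> countably_infinite_subsets |L| \<and> A \<subseteq> h q'"
      by blast
  qed simp
qed

section \<open>The upper bound\<close>

text \<open>
  If \<open>A\<close> is infinite, a dominating set is \<open>K B f\<close>: the points of \<open>Y\<close> which, for each \<open>n\<close>, are within
  \<open>1/(n+1)\<close> of one of the first \<open>f n + 1\<close> elements of the countable set \<open>B\<close>. It is totally bounded for
  arbitrary \<open>B\<close> and \<open>f\<close>, so both may range over cofinal families. If \<open>A\<close> is finite, there are no
  countably infinite subsets to choose from, but then the closure of \<open>A\<close> is itself totally bounded.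
\<close>

lemma precompact_cover_of_closure:
  fixes r :: "'c rel"
  assumes "A \<subseteq> M" and "Y \<subseteq> M" and r: "Cinfinite r" "dominating_number \<le>o r"
    "cofinality (countably_infinite_subsets |A| ) (\<subseteq>) \<le>o r"
  obtains \<K> where "\<K> \<subseteq> precompact_in Y" and "|\<K>| \<le>o r"
    and "\<And>S. S \<in> precompact_in Y \<Longrightarrow> S \<subseteq> mtopology closure_of A \<Longrightarrow> \<exists>K\<in>\<K>. S \<subseteq> K"
proof (cases "finite A")
  case True
  have "mtotally_bounded (mtopology closure_of A)"
    using True assms(1) by (intro mtotally_bounded_closure_of finite_imp_mtotally_bounded)
  then have "mtotally_bounded (Y \<inter> mtopology closure_of A)"
    by (rule mtotally_bounded_subset) simp
  moreover have "|{Y \<inter> mtopology closure_of A}| \<le>o r"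
    using r(1) unfolding cinfinite_def by (intro Card_order_singl_ordLeq) auto
  ultimately show thesis
    by (intro that[of "{Y \<inter> mtopology closure_of A}"]) (auto simp: precompact_in_def)
next
  case False
  obtain \<C> where \<C>: "\<C> \<subseteq> countably_infinite_subsets |A|"
    "\<And>B. B \<in> countably_infinite_subsets |A| \<Longrightarrow> \<exists>C\<in>\<C>. B \<subseteq> C"
    "|\<C>| = cofinality (countably_infinite_subsets |A| ) (\<subseteq>)"
    using cofinal_set_attained[of "countably_infinite_subsets |A|" "(\<subseteq>)"] by blast
  obtain \<D> :: "(nat \<Rightarrow> nat) set" where \<D>: "\<And>f. \<exists>g\<in>\<D>. \<forall>n. f n \<le> g n"
    "|\<D>| = dominating_number"
    using cofinal_set_attained[of "UNIV :: (nat \<Rightarrow> nat) set" "\<lambda>f g. \<forall>n. f n \<le> g n"]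
    unfolding dominating_number_def by auto
  define K where "K B f = {z \<in> Y. \<forall>n. \<exists>j\<le>f n. z \<in> mball (from_nat_into B j) (inverse (Suc n))}"
    for B and f :: "nat \<Rightarrow> nat"
  have K: "K B f \<in> precompact_in Y" for B f
  proof -
    have "mtotally_bounded (K B f)"
    proof (rule mtotally_bounded_outer_centres)
      show "K B f \<subseteq> M"
        using assms(2) unfolding K_def by blast
      fix \<epsilon> :: real assume "0 < \<epsilon>"
      then obtain n where n: "inverse (Suc n) < \<epsilon>"
        using reals_Archimedean by blast
      have "K B f \<subseteq> (\<Union>x\<in>from_nat_into B ` {..f n}. mball x \<epsilon>)"
      proof
        fix z assume "z \<in> K B f"
        then obtain j where "j \<le> f n" "z \<in> mball (from_nat_into B j) (inverse (Suc n))"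
          unfolding K_def by blast
        then show "z \<in> (\<Union>x\<in>from_nat_into B ` {..f n}. mball x \<epsilon>)"
          using n by force
      qed
      then show "\<exists>K'. finite K' \<and> K B f \<subseteq> (\<Union>x\<in>K'. mball x \<epsilon>)"
        by blast
    qed
    then show ?thesis
      unfolding precompact_in_def K_def by blast
  qed
  let ?\<K> = "case_prod K ` (\<C> \<times> \<D>)"
  have "|?\<K>| \<le>o |\<C> \<times> \<D>|"
    by (rule card_of_image)
  also have "|\<C> \<times> \<D>| \<le>o r"
    using r \<C>(3) \<D>(2) by (intro card_of_Times_ordLeq_infinite_Field) (auto simp: cinfinite_def)
  finally have card: "|?\<K>| \<le>o r" .
  have "\<exists>T\<in>?\<K>. S \<subseteq> T" if S: "S \<in> precompact_in Y" "S \<subseteq> mtopology closure_of A" for S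
  proof -
    have "\<exists>F. finite F \<and> F \<subseteq> A \<and> S \<subseteq> (\<Union>x\<in>F. mball x (inverse (Suc n)))" for n
    proof -
      let ?\<epsilon> = "inverse (real (Suc n))"
      have pos: "0 < ?\<epsilon>/2" by simp
      obtain G where G: "finite G" "G \<subseteq> S" "S \<subseteq> (\<Union>x\<in>G. mball x (?\<epsilon>/2))"
        using S(1) pos unfolding precompact_in_def mtotally_bounded_def by blast
      have "\<forall>x\<in>G. \<exists>y\<in>A. y \<in> mball x (?\<epsilon>/2)"
        using G(2) S(2) pos unfolding metric_closure_of by blast
      then obtain c where c: "\<And>x. x \<in> G \<Longrightarrow> c x \<in> A \<and> c x \<in> mball x (?\<epsilon>/2)"
        by metis
      have "S \<subseteq> (\<Union>x\<in>c ` G. mball x ?\<epsilon>)"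
      proof
        fix z assume "z \<in> S"
        then obtain x where x: "x \<in> G" "z \<in> mball x (?\<epsilon>/2)"
          using G(3) by blast
        have mem: "x \<in> M" "z \<in> M" "c x \<in> M" and lt: "d x z < ?\<epsilon>/2" "d x (c x) < ?\<epsilon>/2"
          using x c[OF x(1)] by auto
        have "d (c x) z \<le> d x (c x) + d x z"
          using triangle[of "c x" x z] mem by (simp add: commute)
        then have "d (c x) z < ?\<epsilon>"
          using lt by linarith
        then show "z \<in> (\<Union>x\<in>c ` G. mball x ?\<epsilon>)"
          using x(1) mem by auto
      qed
      then show ?thesis
        using G(1) c by (intro exI[of _ "c ` G"]) auto
    qed
    then obtain F where F: "\<And>n. finite (F n)" "\<And>n. F n \<subseteq> A"
      "\<And>n. S \<subseteq> (\<Union>x\<in>F n. mball x (inverse (Suc n)))"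
      by metis
    \<comment> \<open>The set of centres may be finite; \<open>N\<close> pads it to a countably infinite one.\<close>
    obtain N where N: "N \<subseteq> A" "countable N" "infinite N"
      using False infinite_countable_subset' by blast
    have "(\<Union>n. F n) \<union> N \<in> countably_infinite_subsets |A|"
      unfolding countably_infinite_subsets_def using F N by (auto simp: Field_card_of intro: countable_finite)
    then obtain B where B: "B \<in> \<C>" "(\<Union>n. F n) \<union> N \<subseteq> B"
      using \<C>(2) by blast
    have cB: "countable B"
      using B(1) \<C>(1) unfolding countably_infinite_subsets_def by blast
    obtain g where g: "g \<in> \<D>" "\<And>n. Max (to_nat_on B ` F n) \<le> g n"
      using \<D>(1)[of "\<lambda>n. Max (to_nat_on B ` F n)"] by blast
    have "S \<subseteq> K B g"
    proof
      fix z assume z: "z \<in> S"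
      have "\<exists>j\<le>g n. z \<in> mball (from_nat_into B j) (inverse (Suc n))" for n
      proof -
        obtain y where y: "y \<in> F n" "z \<in> mball y (inverse (Suc n))"
          using F(3)[of n] z by blast
        have "to_nat_on B y \<le> g n"
          by (rule order_trans[OF Max_ge g(2)[of n]]) (use y(1) F(1) in auto)
        moreover have "from_nat_into B (to_nat_on B y) = y"
          using cB B(2) y(1) by (intro from_nat_into_to_nat_on) auto
        ultimately show ?thesis
          using y(2) by metis
      qed
      then show "z \<in> K B g"
        using z S(1) unfolding K_def precompact_in_def by blast
    qed
    then show ?thesis
      using B(1) g(1) by auto
  qed
  moreover have "?\<K> \<subseteq> precompact_in Y"
    using K by auto
  ultimately show thesis
    by (intro that[of ?\<K>] card)
qed

text \<open>
  There may be more than \<open>r\<close> points, so the families \<open>\<K> x\<close> cannot all be used. The balls of radius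
  \<open>1/(n+1)\<close> around points of \<open>D\<close> that lie inside some \<open>V x\<close> still cover the space, there are at most \<open>r\<close>
  of them, and one \<open>x\<close> for each is enough. Finitely many of these balls cover the compact closure of
  a totally bounded set, which splits it into finitely many pieces treated locally.
\<close>

lemma cofinality_precompact_in_ordLeq_local:
  fixes r :: "'c rel"
  assumes "mcomplete" and r: "Cinfinite r"
    and D: "mtopology closure_of D = M" "|D| \<le>o r"
    and V: "\<And>x. x \<in> M \<Longrightarrow> openin mtopology (V x) \<and> x \<in> V x"
    and \<K>: "\<And>x. x \<in> M \<Longrightarrow> \<K> x \<subseteq> precompact_in Y \<and> |\<K> x| \<le>o r \<and>
      (\<forall>S\<in>precompact_in Y. S \<subseteq> V x \<longrightarrow> (\<exists>K\<in>\<K> x. S \<subseteq> K))"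
  shows "cofinality (precompact_in Y) (\<subseteq>) \<le>o r"
proof -
  define B where "B = (\<lambda>(p, n). mball p (inverse (real (Suc n))))"
  define G where "G = {q \<in> D \<times> (UNIV :: nat set). \<exists>x\<in>M. B q \<subseteq> V x}"
  have "\<forall>q\<in>G. \<exists>x. x \<in> M \<and> B q \<subseteq> V x"
    unfolding G_def by blast
  from bchoice[OF this] obtain c where "\<forall>q\<in>G. c q \<in> M \<and> B q \<subseteq> V (c q)" ..
  then have c: "c q \<in> M \<and> B q \<subseteq> V (c q)" if "q \<in> G" for q
    using that by (rule bspec)
  define \<U> where "\<U> = (\<Union>q\<in>G. \<K> (c q))"
  have rF: "infinite (Field r)" and rC: "Card_order r"
    using r by (auto simp: cinfinite_def)
  have "|G| \<le>o |D \<times> (UNIV :: nat set)|"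
    unfolding G_def by (rule card_of_mono1) blast
  also have "|D \<times> (UNIV :: nat set)| \<le>o r"
    by (rule card_of_Times_ordLeq_infinite_Field[OF rF D(2) nat_ordLeq_Cinfinite[OF r] rC])
  finally have "|\<U>| \<le>o r"
    unfolding \<U>_def using c \<K> rF rC by (intro card_of_UNION_ordLeq_infinite_Field) auto
  have \<U>: "\<U> \<subseteq> precompact_in Y"
    using c \<K> unfolding \<U>_def by blast
  let ?\<C> = "{\<Union>\<F> |\<F>. finite \<F> \<and> \<F> \<subseteq> \<U>}"
  have "cofinality (precompact_in Y) (\<subseteq>) \<le>o |?\<C>|"
  proof (rule cofinality_ordLeq_card_of)
    show "?\<C> \<subseteq> precompact_in Y"
      using \<U> unfolding precompact_in_def by (auto intro!: mtotally_bounded_Union)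
    fix S assume S: "S \<in> precompact_in Y"
    let ?S = "mtopology closure_of S"
    have "compactin mtopology ?S"
      using S mtotally_bounded_eq_compact_closure_of[OF \<open>mcomplete\<close>] unfolding precompact_in_def by blast
    moreover have "?S \<subseteq> \<Union>(B ` G)"
    proof
      fix z assume "z \<in> ?S"
      then have z: "z \<in> M"
        using closure_of_subset_topspace by fastforce
      then obtain e where e: "0 < e" "mball z e \<subseteq> V z"
        using V[OF z] openin_mtopology by blast
      obtain n where n: "inverse (Suc n) < e/2"
        using e(1) reals_Archimedean[of "e/2"] by auto
      have "z \<in> mtopology closure_of D" "0 < inverse (real (Suc n))"
        using D(1) z by auto
      then obtain p where p: "p \<in> D" "p \<in> mball z (inverse (Suc n))"
        unfolding metric_closure_of by blast
      have "B (p, n) \<subseteq> mball z e"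
        unfolding B_def prod.case using p(2) n by (intro mball_subset) (auto simp: commute)
      then have "(p, n) \<in> G"
        unfolding G_def using p(1) z e(2) by blast
      moreover have "z \<in> B (p, n)"
        unfolding B_def using p(2) by (auto simp: commute)
      ultimately show "z \<in> \<Union>(B ` G)" by blast
    qed
    moreover have "openin mtopology (B q)" for q
      unfolding B_def by (auto split: prod.split)
    ultimately obtain \<B> where "finite \<B>" "\<B> \<subseteq> B ` G" "?S \<subseteq> \<Union>\<B>"
      unfolding compactin_def by (metis (no_types, lifting) image_iff)
    then obtain G' where G': "finite G'" "G' \<subseteq> G" "?S \<subseteq> \<Union>(B ` G')"
      using finite_subset_image by metis
    have "S \<subseteq> M"
      using S mtotally_bounded_imp_subset unfolding precompact_in_def by blast
    then have SB: "S \<subseteq> \<Union>(B ` G')"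
      using G'(3) closure_of_subset[of S mtopology] by auto
    have "\<exists>K\<in>\<K> (c q). S \<inter> B q \<subseteq> K" if "q \<in> G'" for q
    proof -
      have "S \<inter> B q \<in> precompact_in Y"
        using S mtotally_bounded_subset unfolding precompact_in_def by blast
      moreover have q: "c q \<in> M \<and> B q \<subseteq> V (c q)"
        using that G'(2) by (intro c) blast
      moreover have "S \<inter> B q \<subseteq> V (c q)"
        using q by blast
      ultimately show ?thesis
        using \<K>[of "c q"] by simp
    qed
    then obtain k where k: "\<And>q. q \<in> G' \<Longrightarrow> k q \<in> \<K> (c q) \<and> S \<inter> B q \<subseteq> k q"
      by metis
    have "finite (k ` G') \<and> k ` G' \<subseteq> \<U>"
      using k G'(1,2) unfolding \<U>_def by blast
    moreover have "S \<subseteq> \<Union>(k ` G')"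
      using k SB by blast
    ultimately show "\<exists>C\<in>?\<C>. S \<subseteq> C"
      by blast
  qed
  also have "|?\<C>| \<le>o r"
    by (rule card_of_finite_Unions[OF r \<open>|\<U>| \<le>o r\<close>])
  finally show ?thesis .
qed

text \<open>
  The local families exist at every point: the local density is attained by a dense subset of some
  neighborhood, which lies in the closure of that subset.
\<close>

lemma cofinality_precompact_in_ordLeq:
  fixes r :: "'c rel"
  assumes "mcomplete" and "Y \<subseteq> M" and r: "Cinfinite r" "dominating_number \<le>o r"
    and D: "mtopology closure_of D = M" "|D| \<le>o r"
    and cof: "\<And>x. x \<in> M \<Longrightarrow>
      cofinality (countably_infinite_subsets (local_density mtopology x)) (\<subseteq>) \<le>o r"
  shows "cofinality (precompact_in Y) (\<subseteq>) \<le>o r"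
proof -
  have "\<exists>V \<K>. openin mtopology V \<and> x \<in> V \<and> \<K> \<subseteq> precompact_in Y \<and> |\<K>| \<le>o r \<and>
      (\<forall>S\<in>precompact_in Y. S \<subseteq> V \<longrightarrow> (\<exists>K\<in>\<K>. S \<subseteq> K))" if x: "x \<in> M" for x
  proof -
    obtain U A where U: "U \<in> neighborhoods mtopology x" and A: "A \<subseteq> U" "U \<subseteq> mtopology closure_of A"
      "|A| = local_density mtopology x"
      using local_density_attained[of x mtopology] x by auto
    obtain V where V: "openin mtopology V" "x \<in> V" "V \<subseteq> U" and UM: "U \<subseteq> M"
      using U unfolding neighborhoods_def by auto
    have "A \<subseteq> M" "cofinality (countably_infinite_subsets |A| ) (\<subseteq>) \<le>o r"
      using A UM cof[OF x] by auto
    then obtain \<K> where \<K>: "\<K> \<subseteq> precompact_in Y" "|\<K>| \<le>o r"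
      "\<And>S. S \<in> precompact_in Y \<Longrightarrow> S \<subseteq> mtopology closure_of A \<Longrightarrow> \<exists>K\<in>\<K>. S \<subseteq> K"
      using precompact_cover_of_closure[OF _ assms(2) r] by blast
    then have "\<forall>S\<in>precompact_in Y. S \<subseteq> V \<longrightarrow> (\<exists>K\<in>\<K>. S \<subseteq> K)"
      using V(3) A(2) by blast
    then show ?thesis
      using V \<K> by blast
  qed
  then obtain V \<K> where "\<And>x. x \<in> M \<Longrightarrow> openin mtopology (V x) \<and> x \<in> V x"
    "\<And>x. x \<in> M \<Longrightarrow> \<K> x \<subseteq> precompact_in Y \<and> |\<K> x| \<le>o r \<and>
      (\<forall>S\<in>precompact_in Y. S \<subseteq> V x \<longrightarrow> (\<exists>K\<in>\<K> x. S \<subseteq> K))"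
    by metis
  then show ?thesis
    by (rule cofinality_precompact_in_ordLeq_local[OF assms(1) r(1) D])
qed

end

section \<open>Passing to the completion\<close>

locale dense_isometry = Metric_space M d + N: Metric_space N e
  for M :: "'a set" and d and N :: "'b set" and e +
  fixes i :: "'a \<Rightarrow> 'b"
  assumes image: "i ` M \<subseteq> N"
    and isometry: "\<And>x y. x \<in> M \<Longrightarrow> y \<in> M \<Longrightarrow> e (i x) (i y) = d x y"
    and dense_image: "N.mtopology closure_of (i ` M) = N"
begin

lemma image_subset_UN_mball_iff:
  assumes "S \<subseteq> M" and "K \<subseteq> M"
  shows "i ` S \<subseteq> (\<Union>x\<in>i ` K. N.mball x r) \<longleftrightarrow> S \<subseteq> (\<Union>x\<in>K. mball x r)"
proof -
  have "i z \<in> N.mball (i x) r \<longleftrightarrow> z \<in> mball x r" if "z \<in> S" "x \<in> K" for x z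
    using that assms image isometry by (auto simp: subset_iff)
  then show ?thesis
    by (fastforce simp: subset_iff)
qed

lemma mtotally_bounded_image_iff:
  assumes "S \<subseteq> M"
  shows "N.mtotally_bounded (i ` S) \<longleftrightarrow> mtotally_bounded S"
proof -
  have "(\<exists>K. finite K \<and> K \<subseteq> i ` S \<and> i ` S \<subseteq> (\<Union>x\<in>K. N.mball x r))
      \<longleftrightarrow> (\<exists>K. finite K \<and> K \<subseteq> S \<and> S \<subseteq> (\<Union>x\<in>K. mball x r))" (is "?L \<longleftrightarrow> ?R") for r
  proof
    assume ?L
    then obtain K where K: "finite K" "K \<subseteq> i ` S" "i ` S \<subseteq> (\<Union>x\<in>K. N.mball x r)"
      by (elim exE conjE)
    obtain K' where K': "K' \<subseteq> S" "finite K'" "K = i ` K'"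
      using finite_subset_image[OF K(1,2)] by (elim exE conjE)
    have "S \<subseteq> (\<Union>x\<in>K'. mball x r)"
      using K(3) image_subset_UN_mball_iff[of S K' r] assms K'(1) unfolding K'(3) by simp
    then show ?R
      using K' by (intro exI conjI)
  next
    assume ?R
    then obtain K where K: "finite K" "K \<subseteq> S" "S \<subseteq> (\<Union>x\<in>K. mball x r)"
      by (elim exE conjE)
    have "i ` S \<subseteq> (\<Union>x\<in>i ` K. N.mball x r)"
      using K(3) image_subset_UN_mball_iff[of S K r] assms K(2) by simp
    then show ?L
      using K by (intro exI[of _ "i ` K"] conjI finite_imageI image_mono)
  qed
  then show ?thesis
    unfolding mtotally_bounded_def N.mtotally_bounded_def by presburger
qed

lemma cofinality_precompact_image:
  "cofinality {S. S \<subseteq> M \<and> mtotally_bounded S} (\<subseteq>) =o cofinality (N.precompact_in (i ` M)) (\<subseteq>)"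
  unfolding ordIso_iff_ordLeq
proof
  have pull: "{x \<in> M. i x \<in> T} \<subseteq> M \<and> mtotally_bounded {x \<in> M. i x \<in> T}"
    if "T \<in> N.precompact_in (i ` M)" for T
  proof -
    have "i ` {x \<in> M. i x \<in> T} = T"
      using that unfolding N.precompact_in_def by blast
    then show ?thesis
      using that mtotally_bounded_image_iff[of "{x \<in> M. i x \<in> T}"] unfolding N.precompact_in_def by auto
  qed
  have push: "i ` S \<in> N.precompact_in (i ` M)" if "S \<subseteq> M" "mtotally_bounded S" for S
    using that mtotally_bounded_image_iff unfolding N.precompact_in_def by blast
  show "cofinality {S. S \<subseteq> M \<and> mtotally_bounded S} (\<subseteq>) \<le>o cofinality (N.precompact_in (i ` M)) (\<subseteq>)"
  proof (rule cofinality_ordLeq_Tukey[where h = "\<lambda>T. {x \<in> M. i x \<in> T}"])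
    fix S assume "S \<in> {S. S \<subseteq> M \<and> mtotally_bounded S}"
    then show "\<exists>T\<in>N.precompact_in (i ` M). \<forall>T'\<in>N.precompact_in (i ` M). T \<subseteq> T' \<longrightarrow>
        {x \<in> M. i x \<in> T'} \<in> {S. S \<subseteq> M \<and> mtotally_bounded S} \<and> S \<subseteq> {x \<in> M. i x \<in> T'}"
      using push pull by (intro bexI[of _ "i ` S"]) auto
  qed simp
  show "cofinality (N.precompact_in (i ` M)) (\<subseteq>) \<le>o cofinality {S. S \<subseteq> M \<and> mtotally_bounded S} (\<subseteq>)"
  proof (rule cofinality_ordLeq_Tukey[where h = "image i"])
    fix T assume T: "T \<in> N.precompact_in (i ` M)"
    then have "T = i ` {x \<in> M. i x \<in> T}"
      unfolding N.precompact_in_def by blast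
    then have "T \<subseteq> i ` S" if "{x \<in> M. i x \<in> T} \<subseteq> S" for S
      using that by blast
    then show "\<exists>S\<in>{S. S \<subseteq> M \<and> mtotally_bounded S}. \<forall>S'\<in>{S. S \<subseteq> M \<and> mtotally_bounded S}. S \<subseteq> S' \<longrightarrow>
        i ` S' \<in> N.precompact_in (i ` M) \<and> T \<subseteq> i ` S'"
      using push pull[OF T] by (intro bexI[of _ "{x \<in> M. i x \<in> T}"]) auto
  qed simp
qed

lemma dense_image_iff:
  assumes "D \<subseteq> M"
  shows "N.mtopology closure_of (i ` D) = N \<longleftrightarrow> mtopology closure_of D = M"
proof
  assume L: "N.mtopology closure_of (i ` D) = N"
  have "x \<in> mtopology closure_of D" if x: "x \<in> M" for x
    unfolding metric_closure_of
  proof (intro CollectI conjI allI impI)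
    fix r :: real assume "0 < r"
    have "i x \<in> N.mtopology closure_of (i ` D)"
      using L image x by blast
    then obtain y where "y \<in> D" "i y \<in> N.mball (i x) r"
      using \<open>0 < r\<close> unfolding N.metric_closure_of by blast
    then show "\<exists>y\<in>D. y \<in> mball x r"
      using assms x isometry by (intro bexI[of _ y]) auto
  qed (use x in simp)
  then show "mtopology closure_of D = M"
    using closure_of_subset_topspace[of mtopology D] by auto
next
  assume L: "mtopology closure_of D = M"
  have "i ` M \<subseteq> N.mtopology closure_of (i ` D)"
    unfolding N.metric_closure_of
  proof (intro subsetI CollectI conjI allI impI)
    fix z and r :: real assume "z \<in> i ` M" "0 < r"
    then obtain x where x: "x \<in> M" "z = i x" by blast
    then have "x \<in> mtopology closure_of D"
      using L by simp
    then obtain y where "y \<in> D" "y \<in> mball x r"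
      using \<open>0 < r\<close> unfolding metric_closure_of by blast
    then show "\<exists>y\<in>i ` D. y \<in> N.mball z r"
      using x isometry image by (intro bexI[of _ "i y"]) auto
  qed (use image in blast)
  then show "N.mtopology closure_of (i ` D) = N"
    using dense_image closure_of_mono[of "i ` M" "N.mtopology closure_of (i ` D)" N.mtopology]
      closure_of_subset_topspace[of N.mtopology "i ` D"] by auto
qed

end

theorem theorem4p5:
  fixes X :: "'a metric" and X' :: "'b metric" and i :: "'a \<Rightarrow> 'b"
  assumes "is_completion X X' i"
    and "\<not> locally_compact_space (mtopology_of X')"
  shows "cofinality (precompact_sets X) (\<subseteq>) =o
    (top_density (mtopology_of X) *c dominating_number) *c
      sup_cardinal {cofinality (countably_infinite_subsets (local_density (mtopology_of X') x)) (\<subseteq>)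
                    |x. x \<in> mspace X'}"
proof -
  interpret dense_isometry "mspace X" "mdist X" "mspace X'" "mdist X'" i
    using assms(1) unfolding is_completion_def dense_isometry_def dense_isometry_axioms_def
    by (auto simp: mtopology_of_def Metric_space_mspace_mdist)
  have top: "mtopology_of X = mtopology" "mtopology_of X' = N.mtopology"
    by (simp_all add: mtopology_of_def)
  have complete: "N.mcomplete"
    using assms(1) unfolding is_completion_def mcomplete_of_def by blast
  let ?Y = "i ` mspace X"
  let ?PK = "cofinality (N.precompact_in ?Y) (\<subseteq>)"
  let ?cof = "\<lambda>x. cofinality (countably_infinite_subsets (local_density (mtopology_of X') x)) (\<subseteq>)"
  let ?R = "{?cof x |x. x \<in> mspace X'}"
  let ?d = "top_density (mtopology_of X)"
  let ?r = "(?d *c dominating_number) *c sup_cardinal ?R"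
  obtain x0 where x0: "x0 \<in> mspace X'" "\<And>r. 0 < r \<Longrightarrow> \<not> N.mtotally_bounded (?Y \<inter> N.mball x0 r)"
    using N.non_locally_compact_point[OF complete dense_image] assms(2) top by metis
  have ntbY: "\<not> N.mtotally_bounded ?Y"
    using x0(2)[of 1] N.mtotally_bounded_subset by auto
  have coR: "Card_order s" if "s \<in> ?R" for s
    using that Card_order_cofinality[where le = "(\<subseteq>)"] by auto
  have coPK: "Card_order ?PK"
    by (rule Card_order_cofinality) simp
  have coD: "Card_order dominating_number"
    unfolding dominating_number_def by (rule Card_order_cofinality) simp
  have infPK: "cinfinite ?PK"
  proof -
    obtain \<C> where "\<C> \<subseteq> N.precompact_in ?Y" "\<And>S. S \<in> N.precompact_in ?Y \<Longrightarrow> \<exists>K\<in>\<C>. S \<subseteq> K" "|\<C>| = ?PK"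
      using cofinal_set_attained[of "N.precompact_in ?Y" "(\<subseteq>)"] by blast
    then show ?thesis
      using N.infinite_cofinal_family[OF image ntbY, of \<C>]
      by (metis cinfinite_def Field_card_of)
  qed
  have "?d \<le>o ?PK"
  proof -
    obtain D' where D': "D' \<subseteq> ?Y" "N.mtopology closure_of D' = mspace X'" "|D'| \<le>o ?PK"
      using N.dense_subset_ordLeq_cofinality[OF image dense_image ntbY] by blast
    obtain D where D: "D \<subseteq> mspace X" "inj_on i D" "D' = i ` D"
      using D'(1) subset_image_inj[of D' i "mspace X"] by blast
    have "?d \<le>o |D|"
      unfolding top using D D'(2) dense_image_iff by (intro top_density_ordLeq_card_of) auto
    also have "|D| \<le>o |D'|"
      using D card_of_ordLeq[of D D'] by blast
    also note D'(3)
    finally show ?thesis .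
  qed
  moreover have "dominating_number \<le>o ?PK"
    by (rule N.dominating_number_ordLeq_cofinality[OF x0(1) image x0(2)])
  moreover have "sup_cardinal ?R \<le>o ?PK"
  proof (rule sup_cardinal(3)[OF coR coPK])
    fix s assume "s \<in> ?R"
    then show "s \<le>o ?PK"
      using N.cofinality_countable_subsets_ordLeq_cofinality[OF _ image dense_image] top by auto
  qed
  ultimately have lower: "?r \<le>o ?PK"
    using coPK coD infPK sup_cardinal(1)[of ?R] coR Card_order_top_density
    by (intro cprod_cinfinite_bound Card_order_cprod) auto

  obtain D where D: "D \<subseteq> mspace X" "mtopology closure_of D = mspace X" "|D| = ?d"
    using dense_set_attained[of mtopology] top by auto
  have iD: "i ` D \<subseteq> mspace X'" "N.mtopology closure_of (i ` D) = mspace X'"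
    using D dense_image_iff[OF D(1)] order_trans[OF image_mono[OF D(1)] image] by simp_all
  have "infinite D"
  proof
    assume "finite D"
    then have "N.mtotally_bounded (mspace X')"
      using iD N.finite_imp_mtotally_bounded[of "i ` D"] N.mtotally_bounded_closure_of[of "i ` D"] by auto
    then show False
      using ntbY image N.mtotally_bounded_subset by blast
  qed
  then have d: "Cinfinite ?d"
    unfolding D(3)[symmetric] using card_of_Card_order[of D] by (simp add: cinfinite_def Field_card_of)
  have nzD: "Cnotzero dominating_number"
  proof -
    obtain \<D> :: "(nat \<Rightarrow> nat) set" where "\<And>f. \<exists>g\<in>\<D>. \<forall>n. f n \<le> g n" "|\<D>| = dominating_number"
      using cofinal_set_attained[of "UNIV :: (nat \<Rightarrow> nat) set" "\<lambda>f g. \<forall>n. f n \<le> g n"]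
      unfolding dominating_number_def by auto
    then show ?thesis
      by (metis card_of_Card_order card_of_ordIso_czero_iff_empty empty_iff)
  qed
  \<comment> \<open>The supremum is not zero because the local density is infinite at \<open>x0\<close>: a finite dense subset would
    make a neighborhood of \<open>x0\<close> totally bounded.\<close>
  have nzS: "Cnotzero (sup_cardinal ?R)"
  proof (rule Cnotzero_mono)
    obtain U A where U: "U \<in> neighborhoods N.mtopology x0" and A: "A \<subseteq> U" "U \<subseteq> N.mtopology closure_of A"
      "|A| = local_density N.mtopology x0"
      using local_density_attained[of x0 N.mtopology] x0(1) by auto
    obtain V where V: "openin N.mtopology V" "x0 \<in> V" "V \<subseteq> U" and UM: "U \<subseteq> mspace X'"
      using U unfolding neighborhoods_def by auto
    obtain e where e: "0 < e" "N.mball x0 e \<subseteq> V"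
      using V N.openin_mtopology by blast
    have "infinite A"
    proof
      assume "finite A"
      then have "N.mtotally_bounded (N.mtopology closure_of A)"
        using A(1) UM N.finite_imp_mtotally_bounded N.mtotally_bounded_closure_of by blast
      moreover have "?Y \<inter> N.mball x0 e \<subseteq> N.mtopology closure_of A"
        using e(2) V(3) A(2) by blast
      ultimately show False
        using x0(2)[OF e(1)] N.mtotally_bounded_subset by blast
    qed
    then obtain B where "B \<subseteq> A" "countable B" "infinite B"
      using infinite_countable_subset' by blast
    then have B: "B \<in> countably_infinite_subsets |A|"
      unfolding countably_infinite_subsets_def by (simp add: Field_card_of)
    obtain \<C> where \<C>: "\<C> \<subseteq> countably_infinite_subsets |A|"
      "\<And>B. B \<in> countably_infinite_subsets |A| \<Longrightarrow> \<exists>C\<in>\<C>. B \<subseteq> C"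
      "|\<C>| = cofinality (countably_infinite_subsets |A| ) (\<subseteq>)"
      using cofinal_set_attained[of "countably_infinite_subsets |A|" "(\<subseteq>)"] by blast
    then have "\<C> \<noteq> {}" "|\<C>| = ?cof x0"
      using B A(3) top by auto
    then show "Cnotzero (?cof x0)"
      by (metis card_of_Card_order card_of_ordIso_czero_iff_empty)
    show "?cof x0 \<le>o sup_cardinal ?R"
      using x0(1) by (intro sup_cardinal(2)[OF coR]) auto
  qed (rule sup_cardinal(1)[OF coR])
  have dD: "Cinfinite (?d *c dominating_number)"
    using d nzD cinfinite_mono[OF ordLeq_cprod_left[of ?d dominating_number]] Card_order_cprod by blast
  have le1: "?d *c dominating_number \<le>o ?r"
    using dD nzS by (intro ordLeq_cprod_left) auto
  have "?PK \<le>o ?r"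
  proof (rule N.cofinality_precompact_in_ordLeq[OF complete image _ _ iD(2)])
    show "Cinfinite ?r"
      using dD cinfinite_mono[OF le1] Card_order_cprod by blast
    show "dominating_number \<le>o ?r"
      using ordLeq_transitive[OF ordLeq_cprod2 le1] Cinfinite_Cnotzero[OF d] coD by blast
    have "|i ` D| \<le>o ?d"
      using card_of_image[of i D] D(3) by simp
    also have "?d \<le>o ?d *c dominating_number"
      using d nzD by (intro ordLeq_cprod_left) auto
    also note le1
    finally show "|i ` D| \<le>o ?r" .
    fix x assume "x \<in> mspace X'"
    then have "?cof x \<le>o sup_cardinal ?R"
      by (intro sup_cardinal(2)[OF coR]) auto
    also have "sup_cardinal ?R \<le>o ?r"
      using Cinfinite_Cnotzero[OF dD] sup_cardinal(1)[OF coR] by (intro ordLeq_cprod2)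
    finally show "cofinality (countably_infinite_subsets (local_density N.mtopology x)) (\<subseteq>) \<le>o ?r"
      unfolding top .
  qed
  then have "?PK =o ?r"
    using lower ordIso_iff_ordLeq by blast
  moreover have "cofinality (precompact_sets X) (\<subseteq>) =o ?PK"
    using cofinality_precompact_image unfolding precompact_sets_def .
  ultimately show ?thesis
    using ordIso_transitive by blast
qed

end
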